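(* Let $\alpha>0$, let $F$ be a continuous distribution function of a positive random variable $X$, let $R(x)=\sum_{n=0}^{\infty}F^{\boxtimes n}(x)$ be the Kendall renewal function of $F$, and let $y>0$. Suppose that $m(\alpha)=E(X^\alpha)<\infty$ and that $x^{\alpha+1}\bigl(\overline{F}(x+y)-\overline{F}(x)\bigr)\to0$ as $x\to\infty$. Then $$\lim_{x\to\infty}\frac{1}{x^{\alpha-1}}\bigl(R(x+y)-R(x)\bigr)=\frac{2\alpha}{m(\alpha)}\,y.$$ In particular, if $m(1+\alpha)=E(X^{1+\alpha})<\infty$, the result holds.
   Context: Fix $\alpha>0$. $X$ is a positive random variable with distribution function $F(x)=P(X\le x)$, $F(0-)=0$, $F$ continuous; $\overline{F}=1-F$; $m(\sigma)=\int_0^\infty y^\sigma\,dF(y)$ for $\sigma>0$. The Williamson transform ($G$-transform) of a distribution function $F$ with $F(0-)=0$ is $G_F(x)=\int_0^x\bigl(1-(t/x)^\alpha\bigr)\,dF(t)$, $x>0$. The Kendall convolution $F_1\boxtimes F_2$ of two distribution functions with $F_i(0-)=0$ is the distribution function $F_3$ (with $F_3(0-)=0$) determined by $G_{F_3}(x)=G_{F_1}(x)G_{F_2}(x)$. The $n$-fold Kendall convolution $F^{\boxtimes n}$ is thus the distribution function with $G$-transform $G_F^n$, and $F^{\boxtimes 0}$ is the distribution function of the point mass at $0$. *)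

theory Defs
  imports "HOL-Probability.Probability"
begin

text \<open>Distribution functions \<open>F\<close> with \<open>F(0-) = 0\<close>, i.e. of probability measures on \<open>[0, \<infinity>)\<close>.\<close>

definition nonneg_df :: "(real \<Rightarrow> real) \<Rightarrow> bool" where
  "nonneg_df F \<longleftrightarrow>
     mono F \<and> (\<forall>x. continuous (at_right x) F) \<and> (\<forall>x<0. F x = 0) \<and> (F \<longlongrightarrow> 1) at_top"

text \<open>The integral \<open>\<integral>\<^sub>0\<^sup>x \<dots> dF\<close> includes the atom that \<open>F\<close> may have at \<open>0\<close> (so the transform of
  the point mass at \<open>0\<close> is constantly \<open>1\<close>). Only arguments \<open>x > 0\<close> are meaningful.\<close>

definition williamson :: "real \<Rightarrow> (real \<Rightarrow> real) \<Rightarrow> real \<Rightarrow> real" where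
  "williamson \<alpha> F x = (LINT t:{0..x}|interval_measure F. 1 - (t / x) powr \<alpha>)"

text \<open>For \<open>\<alpha> > 0\<close> and distribution functions on \<open>[0, \<infinity>)\<close> the function described here exists and
  is unique; outside that case the value is unspecified.\<close>

definition kendall_conv :: "real \<Rightarrow> (real \<Rightarrow> real) \<Rightarrow> (real \<Rightarrow> real) \<Rightarrow> real \<Rightarrow> real" where
  "kendall_conv \<alpha> F\<^sub>1 F\<^sub>2 =
     (THE F\<^sub>3. nonneg_df F\<^sub>3 \<and>
       (\<forall>x>0. williamson \<alpha> F\<^sub>3 x = williamson \<alpha> F\<^sub>1 x * williamson \<alpha> F\<^sub>2 x))"

primrec kendall_power :: "real \<Rightarrow> (real \<Rightarrow> real) \<Rightarrow> nat \<Rightarrow> real \<Rightarrow> real" where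
  "kendall_power \<alpha> F 0 = cdf (return borel 0)"
| "kendall_power \<alpha> F (Suc n) = kendall_conv \<alpha> (kendall_power \<alpha> F n) F"

text \<open>The series converges at every \<open>x\<close> when \<open>\<alpha> > 0\<close> and \<open>F\<close> is the distribution function of a
  positive random variable, so the real-valued sum is not a default value there.\<close>

definition kendall_renewal :: "real \<Rightarrow> (real \<Rightarrow> real) \<Rightarrow> real \<Rightarrow> real" where
  "kendall_renewal \<alpha> F x = (\<Sum>n. kendall_power \<alpha> F n x)"

definition tail :: "(real \<Rightarrow> real) \<Rightarrow> real \<Rightarrow> real" where
  "tail F x = 1 - F x"

end

theory Submission
  imports Defs
begin

text \<open>Write \<open>G\<close> for the Williamson transform of \<open>F\<close>. The function \<open>x\<^sup>\<alpha> G(x)\<close> is the integral of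
  \<open>(x\<^sup>\<alpha> - t\<^sup>\<alpha>)\<^sup>+\<close> against \<open>dF(t)\<close>, so its increment over \<open>[x, z]\<close> lies between \<open>F(x)\<close> and \<open>F(z)\<close>
  times \<open>z\<^sup>\<alpha> - x\<^sup>\<alpha>\<close> (\<open>scaled_williamson_increment\<close>). In other words \<open>F\<close> is the derivative of
  \<open>x\<^sup>\<alpha> G(x)\<close> with respect to \<open>x\<^sup>\<alpha>\<close>. Everything about the transform follows from this squeeze: its
  injectivity, and, by differentiating \<open>x\<^sup>\<alpha> G(x)\<^sup>n\<close>, the explicit inversion
  \<open>F\<^sup>\<boxtimes>\<^sup>n = n G\<^sup>n\<^sup>-\<^sup>1 F - (n - 1) G\<^sup>n\<close> of the powers of \<open>G\<close> (\<open>kendall_power_eq\<close>).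

  Summing this arithmetico-geometric series gives the renewal function in closed form,
  \<open>R = 2 / (1 - G) - (1 - F) / (1 - G)\<^sup>2\<close> (\<open>kendall_renewal_eq\<close>). With the truncated moment
  \<open>I(x) = x\<^sup>\<alpha> (1 - G(x)) = E min(X, x)\<^sup>\<alpha>\<close>, which increases to \<open>m(\<alpha>)\<close>, this reads
  \<open>R(x) = 2 x\<^sup>\<alpha> / I(x) - (1 - F(x)) x\<^sup>2\<^sup>\<alpha> / I(x)\<^sup>2\<close>. In the increment of \<open>R\<close> over \<open>[x, x + y]\<close>, the
  increment of \<open>2 x\<^sup>\<alpha>\<close> contributes \<open>2 \<alpha> y x\<^sup>\<alpha>\<^sup>-\<^sup>1 / m(\<alpha>)\<close> to leading order. The other
  terms are of smaller order than \<open>x\<^sup>\<alpha>\<^sup>-\<^sup>1\<close>: a change of \<open>I\<close> or of the factor \<open>x\<^sup>2\<^sup>\<alpha>\<close> costs at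
  least one factor \<open>x\<^sup>\<alpha> (1 - F(x))\<close>, which vanishes because \<open>m(\<alpha>)\<close> is finite, and the change of
  \<open>1 - F\<close> is exactly what the hypothesis on the tail increments controls. If \<open>m(1 + \<alpha>)\<close> is finite,
  that hypothesis holds since already \<open>x\<^sup>1\<^sup>+\<^sup>\<alpha> (1 - F(x))\<close> vanishes.\<close>

section \<open>Distribution functions on the half-line\<close>

lemma nonneg_df_at_bot:
  assumes "nonneg_df H"
  shows "(H \<longlongrightarrow> 0) at_bot"
proof -
  have "eventually (\<lambda>x. H x = 0) at_bot"
    unfolding eventually_at_bot_linorder
    by (rule exI[of _ "-1"]) (use assms in \<open>auto simp: nonneg_df_def\<close>)
  then show ?thesis by (rule tendsto_eventually)
qed

lemma nonneg_df_real_distribution: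
  assumes "nonneg_df H"
  shows "real_distribution (interval_measure H)"
  by (rule real_distribution_interval_measure)
    (use assms nonneg_df_at_bot[OF assms] in \<open>auto simp: nonneg_df_def mono_def\<close>)

lemma nonneg_df_cdf:
  assumes "nonneg_df H"
  shows "cdf (interval_measure H) = H"
  by (rule cdf_interval_measure)
    (use assms nonneg_df_at_bot[OF assms] in \<open>auto simp: nonneg_df_def mono_def\<close>)

lemma nonneg_df_measure_negative:
  assumes "nonneg_df H"
  shows "measure (interval_measure H) {..<0} = 0"
proof -
  interpret real_distribution "interval_measure H"
    by (rule nonneg_df_real_distribution[OF assms])
  have "(H \<longlongrightarrow> measure (interval_measure H) {..<0}) (at_left 0)"
    using cdf_at_left[of 0] by (simp add: nonneg_df_cdf[OF assms])
  moreover have "(H \<longlongrightarrow> 0) (at_left 0)"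
    by (rule tendsto_eventually)
      (use assms in \<open>auto simp: nonneg_df_def eventually_at_filter\<close>)
  ultimately show ?thesis
    by (rule tendsto_unique[OF trivial_limit_at_left_real])
qed

lemma nonneg_df_measure_Icc0:
  assumes "nonneg_df H" "x \<ge> 0"
  shows "measure (interval_measure H) {0..x} = H x"
proof -
  interpret real_distribution "interval_measure H"
    by (rule nonneg_df_real_distribution[OF assms(1)])
  have "{..x} = {..<0} \<union> {0..x}" using assms(2) by auto
  then have "measure (interval_measure H) {..x}
      = measure (interval_measure H) {..<0} + measure (interval_measure H) {0..x}"
    by (simp only:) (rule finite_measure_Union, auto)
  then show ?thesis
    using nonneg_df_cdf[OF assms(1)] nonneg_df_measure_negative[OF assms(1)]
    by (metis add_0 cdf_def2)
qed

lemma nonneg_df_bounds: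
  assumes "nonneg_df H"
  shows "0 \<le> H x" "H x \<le> 1"
proof -
  interpret real_distribution "interval_measure H"
    by (rule nonneg_df_real_distribution[OF assms])
  show "0 \<le> H x" "H x \<le> 1"
    using cdf_nonneg[of x] cdf_bounded_prob[of x] by (simp_all add: nonneg_df_cdf[OF assms])
qed

section \<open>The Williamson transform as an antiderivative\<close>

definition scaled_williamson :: "real \<Rightarrow> (real \<Rightarrow> real) \<Rightarrow> real \<Rightarrow> real" where
  "scaled_williamson \<alpha> H x = x powr \<alpha> * williamson \<alpha> H x"

lemma scaled_williamson_eq_integral:
  "scaled_williamson \<alpha> H x
     = (LINT t|interval_measure H. indicator {0..x} t * (x powr \<alpha> - t powr \<alpha>))"
proof -
  have "scaled_williamson \<alpha> H x
      = (LINT t|interval_measure H. x powr \<alpha> * (indicator {0..x} t *\<^sub>R (1 - (t / x) powr \<alpha>)))"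
    unfolding scaled_williamson_def williamson_def set_lebesgue_integral_def by simp
  also have "\<dots> = (LINT t|interval_measure H. indicator {0..x} t * (x powr \<alpha> - t powr \<alpha>))"
    by (intro Bochner_Integration.integral_cong)
      (auto simp: indicator_def powr_divide algebra_simps)
  finally show ?thesis .
qed

lemma integrable_scaled_williamson:
  assumes "nonneg_df H" "\<alpha> > 0"
  shows "integrable (interval_measure H) (\<lambda>t. indicator {0..x} t * (x powr \<alpha> - t powr \<alpha>))"
proof -
  interpret real_distribution "interval_measure H"
    by (rule nonneg_df_real_distribution[OF assms(1)])
  have "\<bar>indicator {0..x} t * (x powr \<alpha> - t powr \<alpha>)\<bar> \<le> x powr \<alpha>" for t
    using powr_mono2[of \<alpha> t x] assms(2) by (auto simp: indicator_def)
  then show ?thesis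
    by (intro integrable_const_bound[where B = "x powr \<alpha>"]) auto
qed

text \<open>Pointwise in \<open>t\<close>, the difference \<open>(z\<^sup>\<alpha> - t\<^sup>\<alpha>)\<^sup>+ - (x\<^sup>\<alpha> - t\<^sup>\<alpha>)\<^sup>+\<close> equals \<open>z\<^sup>\<alpha> - x\<^sup>\<alpha>\<close> for
  \<open>t \<le> x\<close>, vanishes for \<open>t > z\<close>, and is in between otherwise. This estimate replaces integration by
  parts, and thereby avoids the singularity of \<open>t\<^sup>\<alpha>\<^sup>-\<^sup>1\<close> at \<open>0\<close> when \<open>\<alpha> < 1\<close>.\<close>

lemma scaled_williamson_increment:
  assumes "nonneg_df H" "\<alpha> > 0" "0 \<le> x" "x \<le> z"
  shows "H x * (z powr \<alpha> - x powr \<alpha>) \<le> scaled_williamson \<alpha> H z - scaled_williamson \<alpha> H x"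
    and "scaled_williamson \<alpha> H z - scaled_williamson \<alpha> H x \<le> H z * (z powr \<alpha> - x powr \<alpha>)"
proof -
  let ?\<mu> = "interval_measure H"
  interpret real_distribution ?\<mu>
    by (rule nonneg_df_real_distribution[OF assms(1)])
  let ?k = "\<lambda>x t. indicator {0..x} t * (x powr \<alpha> - t powr \<alpha>) :: real"
  have int: "integrable ?\<mu> (\<lambda>t. ?k z t - ?k x t)"
    by (intro Bochner_Integration.integrable_diff integrable_scaled_williamson assms)
  have eq: "scaled_williamson \<alpha> H z - scaled_williamson \<alpha> H x = (LINT t|?\<mu>. ?k z t - ?k x t)"
    unfolding scaled_williamson_eq_integral
    by (intro Bochner_Integration.integral_diff[symmetric] integrable_scaled_williamson assms)
  have box: "H u * c = (LINT t|?\<mu>. indicator {0..u} t * c)" if "u \<ge> 0" for u c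
    using nonneg_df_measure_Icc0[OF assms(1) that] by simp
  have lower: "indicator {0..x} t * (z powr \<alpha> - x powr \<alpha>) \<le> ?k z t - ?k x t" for t
    using assms powr_mono2[of \<alpha> t z] by (auto simp: indicator_def)
  have upper: "?k z t - ?k x t \<le> indicator {0..z} t * (z powr \<alpha> - x powr \<alpha>)" for t
    using assms powr_mono2[of \<alpha> x t] by (auto simp: indicator_def)
  have ind: "integrable ?\<mu> (indicator {0..u} :: real \<Rightarrow> real)" for u
    by (intro integrable_const_bound[where B = 1]) auto
  show "H x * (z powr \<alpha> - x powr \<alpha>) \<le> scaled_williamson \<alpha> H z - scaled_williamson \<alpha> H x"
    unfolding eq box[OF assms(3)]
    by (intro integral_mono int lower integrable_mult_left ind)
  have "z \<ge> 0" using assms by simp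
  then show "scaled_williamson \<alpha> H z - scaled_williamson \<alpha> H x \<le> H z * (z powr \<alpha> - x powr \<alpha>)"
    unfolding eq box[OF \<open>z \<ge> 0\<close>]
    by (intro integral_mono int upper integrable_mult_left ind)
qed

lemma scaled_williamson_0 [simp]: "\<alpha> > 0 \<Longrightarrow> scaled_williamson \<alpha> H 0 = 0"
  by (simp add: scaled_williamson_def)

text \<open>The set \<open>S\<close> serves two purposes: with the right neighbourhood of \<open>x\<close> the derivative exists for
  every distribution function, which gives uniqueness; with the full neighbourhood it exists
  wherever \<open>H\<close> is continuous, which gives the inversion formula.\<close>

lemma scaled_williamson_has_field_derivative:
  assumes "nonneg_df H" "\<alpha> > 0" "0 < x" "(H \<longlongrightarrow> H x) (at x within S)"
  shows "(scaled_williamson \<alpha> H has_field_derivative \<alpha> * x powr (\<alpha> - 1) * H x) (at x within S)"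
proof -
  let ?W = "scaled_williamson \<alpha> H"
  let ?q = "\<lambda>z. (?W z - ?W x) / (z powr \<alpha> - x powr \<alpha>)"
  have strict: "u powr \<alpha> < v powr \<alpha>" if "0 \<le> u" "u < v" for u v
    using that assms(2) by (intro powr_less_mono2) auto
  have mono: "H u \<le> H v" if "u \<le> v" for u v
    using assms(1) that by (auto simp: nonneg_df_def mono_def)
  (* The quotient with respect to the powers lies between H x and H z, by the increment bounds. *)
  have q_bound: "\<bar>?q z - H x\<bar> \<le> \<bar>H z - H x\<bar>" if "z > 0" "z \<noteq> x" for z
  proof (cases "x < z")
    case True
    have "0 < z powr \<alpha> - x powr \<alpha>" using strict[of x z] True assms(3) by simp
    then have "H x \<le> ?q z" "?q z \<le> H z"
      using scaled_williamson_increment[OF assms(1,2), of x z] True assms(3)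
      by (auto simp: field_simps)
    then show ?thesis using mono[of x z] True by auto
  next
    case False
    then have "z < x" using that by simp
    have "0 < x powr \<alpha> - z powr \<alpha>" using strict[of z x] \<open>z < x\<close> that by simp
    moreover have "?q z = (?W x - ?W z) / (x powr \<alpha> - z powr \<alpha>)"
      by (metis minus_diff_eq minus_divide_divide)
    ultimately have "H z \<le> ?q z" "?q z \<le> H x"
      using scaled_williamson_increment[OF assms(1,2), of z x] \<open>z < x\<close> that
      by (auto simp: field_simps)
    then show ?thesis using mono[of z x] \<open>z < x\<close> by auto
  qed
  have near: "eventually (\<lambda>z. z > 0 \<and> z \<noteq> x) (at x within S)"
    using assms(3) by (auto simp: eventually_at dist_real_def intro!: exI[of _ x])
  have "(?q \<longlongrightarrow> H x) (at x within S)"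
  proof (rule LIM_zero_cancel, rule Lim_null_comparison)
    show "eventually (\<lambda>z. norm (?q z - H x) \<le> \<bar>H z - H x\<bar>) (at x within S)"
      using near by eventually_elim (use q_bound in simp)
    show "((\<lambda>z. \<bar>H z - H x\<bar>) \<longlongrightarrow> 0) (at x within S)"
      by (intro tendsto_rabs_zero LIM_zero assms)
  qed
  moreover have "((\<lambda>z. (z powr \<alpha> - x powr \<alpha>) / (z - x)) \<longlongrightarrow> \<alpha> * x powr (\<alpha> - 1)) (at x within S)"
    using has_real_derivative_powr[OF assms(3), of \<alpha>, THEN DERIV_subset, of S]
    by (simp add: has_field_derivative_iff)
  ultimately have "((\<lambda>z. (z powr \<alpha> - x powr \<alpha>) / (z - x) * ?q z)
      \<longlongrightarrow> \<alpha> * x powr (\<alpha> - 1) * H x) (at x within S)"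
    by (intro tendsto_mult)
  moreover have "eventually (\<lambda>z. (z powr \<alpha> - x powr \<alpha>) / (z - x) * ?q z
      = (?W z - ?W x) / (z - x)) (at x within S)"
    using near
  proof eventually_elim
    case (elim z)
    then have "z powr \<alpha> - x powr \<alpha> \<noteq> 0"
      using strict[of x z] strict[of z x] assms(3) by (cases "x < z") auto
    then show ?case by simp
  qed
  ultimately show ?thesis
    unfolding has_field_derivative_iff by (rule Lim_transform_eventually)
qed

text \<open>A right-continuous \<open>H\<close> is recovered on the positive axis as a one-sided derivative of its scaled
  transform; the value at \<open>0\<close> then follows by right-continuity.\<close>

lemma williamson_inject:
  assumes "\<alpha> > 0" "nonneg_df H1" "nonneg_df H2"
    and eq: "\<And>x. x > 0 \<Longrightarrow> williamson \<alpha> H1 x = williamson \<alpha> H2 x"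
  shows "H1 = H2"
proof
  have right: "(H \<longlongrightarrow> H x) (at_right x)" if "nonneg_df H" for H :: "real \<Rightarrow> real" and x
    using that by (simp add: nonneg_df_def continuous_within)
  have pos: "H1 x = H2 x" if "x > 0" for x
  proof -
    have "(scaled_williamson \<alpha> H1 has_field_derivative \<alpha> * x powr (\<alpha> - 1) * H1 x) (at_right x)"
      by (intro scaled_williamson_has_field_derivative assms that right)
    then have "(scaled_williamson \<alpha> H2 has_field_derivative \<alpha> * x powr (\<alpha> - 1) * H1 x) (at_right x)"
      unfolding has_field_derivative_iff
      by (rule Lim_transform_eventually)
        (use that eq in \<open>auto simp: scaled_williamson_def eventually_at_filter\<close>)
    moreover have
      "(scaled_williamson \<alpha> H2 has_field_derivative \<alpha> * x powr (\<alpha> - 1) * H2 x) (at_right x)"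
      by (intro scaled_williamson_has_field_derivative assms that right)
    ultimately have "\<alpha> * x powr (\<alpha> - 1) * H1 x = \<alpha> * x powr (\<alpha> - 1) * H2 x"
      unfolding has_field_derivative_iff
      by (rule tendsto_unique[OF trivial_limit_at_right_real])
    then show ?thesis using assms(1) that by simp
  qed
  fix x :: real
  consider "x < 0" | "x = 0" | "x > 0" by linarith
  then show "H1 x = H2 x"
  proof cases
    case 1
    then show ?thesis using assms by (simp add: nonneg_df_def)
  next
    case 2
    have "(H2 \<longlongrightarrow> H1 0) (at_right 0)"
      using right[OF assms(2), of 0]
      by (rule Lim_transform_eventually)
        (auto simp: eventually_at_filter pos)
    then show ?thesis
      using tendsto_unique[OF trivial_limit_at_right_real _ right[OF assms(3)]] 2 by blast
  next
    case 3
    then show ?thesis by (rule pos)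
  qed
qed

section \<open>Elementary properties of the transform\<close>

lemma williamson_eq_scaled: "x > 0 \<Longrightarrow> williamson \<alpha> H x = scaled_williamson \<alpha> H x / x powr \<alpha>"
  by (simp add: scaled_williamson_def)

lemma williamson_bounds:
  assumes "nonneg_df H" "\<alpha> > 0" "x > 0"
  shows "0 \<le> williamson \<alpha> H x" "williamson \<alpha> H x \<le> H x"
proof -
  have "H 0 * x powr \<alpha> \<le> scaled_williamson \<alpha> H x" "scaled_williamson \<alpha> H x \<le> H x * x powr \<alpha>"
    using scaled_williamson_increment[OF assms(1,2), of 0 x] assms by auto
  moreover have "0 \<le> H 0 * x powr \<alpha>"
    by (simp add: nonneg_df_bounds[OF assms(1)])
  ultimately show "0 \<le> williamson \<alpha> H x" "williamson \<alpha> H x \<le> H x"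
    using assms(3) by (auto simp: williamson_eq_scaled divide_le_eq)
qed

text \<open>The transform at \<open>x\<close> is an average of \<open>H\<close> over \<open>[0, x]\<close>, so \<open>G(x) \<le> H(x)\<close>; passing to a larger
  \<open>z\<close> therefore averages in values that are at least \<open>G(x)\<close>.\<close>

lemma williamson_mono:
  assumes "nonneg_df H" "\<alpha> > 0" "0 < x" "x \<le> z"
  shows "williamson \<alpha> H x \<le> williamson \<alpha> H z"
proof -
  have "x powr \<alpha> \<le> z powr \<alpha>" using assms by (intro powr_mono2) auto
  then have "williamson \<alpha> H x * (z powr \<alpha> - x powr \<alpha>) \<le> H x * (z powr \<alpha> - x powr \<alpha>)"
    using williamson_bounds[OF assms(1-3)] by (intro mult_right_mono) auto
  also have "\<dots> \<le> scaled_williamson \<alpha> H z - scaled_williamson \<alpha> H x"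
    using assms by (intro scaled_williamson_increment) auto
  also have "\<dots> = z powr \<alpha> * williamson \<alpha> H z - x powr \<alpha> * williamson \<alpha> H x"
    by (simp add: scaled_williamson_def)
  finally have "z powr \<alpha> * williamson \<alpha> H x \<le> z powr \<alpha> * williamson \<alpha> H z"
    by (simp add: algebra_simps)
  then show ?thesis using assms by simp
qed

lemma williamson_at_top:
  assumes "nonneg_df H" "\<alpha> > 0"
  shows "(williamson \<alpha> H \<longlongrightarrow> 1) at_top"
proof (rule tendsto_sandwich)
  have sqrt_top: "filterlim sqrt at_top at_top"
    by (rule sqrt_at_top)
  have H: "(H \<longlongrightarrow> 1) at_top" using assms by (simp add: nonneg_df_def)
  have "((\<lambda>z. H (sqrt z) * (1 - z powr (- (\<alpha> / 2)))) \<longlongrightarrow> 1 * (1 - 0)) at_top"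
    by (intro tendsto_intros filterlim_compose[OF H sqrt_top] tendsto_neg_powr filterlim_ident)
      (use assms in auto)
  then show "((\<lambda>z. H (sqrt z) * (1 - z powr (- (\<alpha> / 2)))) \<longlongrightarrow> 1) at_top" by simp
  show "(H \<longlongrightarrow> 1) at_top" by (rule H)
  show "eventually (\<lambda>z. williamson \<alpha> H z \<le> H z) at_top"
    using eventually_gt_at_top[of 0] by eventually_elim (rule williamson_bounds[OF assms])
  show "eventually (\<lambda>z. H (sqrt z) * (1 - z powr (- (\<alpha> / 2))) \<le> williamson \<alpha> H z) at_top"
    using eventually_ge_at_top[of 1]
  proof eventually_elim
    case (elim z)
    (* Cutting at sqrt z works: it tends to infinity but is negligible against z. *)
    have half: "sqrt z powr \<alpha> = z powr \<alpha> * z powr (- (\<alpha> / 2))"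
      using elim by (simp add: powr_half_sqrt[symmetric] powr_powr powr_add[symmetric])
    have "sqrt z \<le> z" using elim by (simp add: real_le_lsqrt power2_eq_square)
    then have "H (sqrt z) * (z powr \<alpha> - sqrt z powr \<alpha>)
        \<le> scaled_williamson \<alpha> H z - scaled_williamson \<alpha> H (sqrt z)"
      using elim by (intro scaled_williamson_increment assms) auto
    also have "\<dots> \<le> scaled_williamson \<alpha> H z"
      using williamson_bounds[OF assms, of "sqrt z"] elim by (simp add: scaled_williamson_def)
    finally have "z powr \<alpha> * (H (sqrt z) * (1 - z powr (- (\<alpha> / 2)))) \<le> z powr \<alpha> * williamson \<alpha> H z"
      by (simp add: half scaled_williamson_def algebra_simps)
    then show ?case using elim by simp
  qed
qed

text \<open>Near \<open>0\<close> the distribution function is strictly below \<open>1\<close>, hence so is its average over \<open>[0, x]\<close>.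
  This makes the renewal series a convergent one of geometric type.\<close>

lemma williamson_lt_1:
  assumes "nonneg_df F" "\<alpha> > 0" "isCont F 0" "F 0 = 0" "x > 0"
  shows "williamson \<alpha> F x < 1"
proof -
  have "(F \<longlongrightarrow> 0) (at_right 0)"
    using assms(3,4) by (simp add: continuous_at filterlim_at_split)
  then have "eventually (\<lambda>d. F d < 1) (at_right 0)"
    by (rule order_tendstoD) simp
  moreover have "eventually (\<lambda>d. d \<in> {0<..<x}) (at_right 0)"
    by (rule eventually_at_right_real[OF assms(5)])
  ultimately obtain d where d: "F d < 1" "0 < d" "d < x"
    using eventually_happens'[OF trivial_limit_at_right_real eventually_conj] by fastforce
  have less: "d powr \<alpha> < x powr \<alpha>" using d assms(2) by (intro powr_less_mono2) auto
  have "scaled_williamson \<alpha> F x \<le> scaled_williamson \<alpha> F d + F x * (x powr \<alpha> - d powr \<alpha>)"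
    using scaled_williamson_increment(2)[OF assms(1,2), of d x] d by simp
  also have "\<dots> \<le> scaled_williamson \<alpha> F d + 1 * (x powr \<alpha> - d powr \<alpha>)"
    using less nonneg_df_bounds[OF assms(1)] by (intro add_left_mono mult_right_mono) auto
  also have "scaled_williamson \<alpha> F d < d powr \<alpha>"
    using williamson_bounds[OF assms(1,2) d(2)] d by (simp add: scaled_williamson_def)
  finally have "x powr \<alpha> * williamson \<alpha> F x < x powr \<alpha> * 1"
    by (simp add: scaled_williamson_def)
  then show ?thesis using assms(5) by (subst (asm) mult_less_cancel_left_pos) auto
qed

lemma williamson_nonpos:
  assumes "nonneg_df F" "F 0 = 0" "x \<le> 0"
  shows "williamson \<alpha> F x = 0"
proof (cases "x = 0")
  case True
  have "measure (interval_measure F) {0} = 0"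
    using nonneg_df_measure_Icc0[OF assms(1), of 0] assms(2) by simp
  moreover have "williamson \<alpha> F x = (LINT t|interval_measure F. indicator {0} t)"
    using True unfolding williamson_def set_lebesgue_integral_def by simp
  ultimately show ?thesis by simp
next
  case False
  then have "{0..x} = {}" using assms(3) by simp
  then show ?thesis by (simp add: williamson_def set_lebesgue_integral_def)
qed

text \<open>To the right of \<open>0\<close> the transform is a quotient with a differentiable numerator. On the rest of the
  line, where \<open>F\<close> vanishes, continuity comes from \<open>0 \<le> G \<le> F\<close>.\<close>

lemma isCont_williamson:
  assumes "nonneg_df F" "\<alpha> > 0" "isCont F x" "F 0 = 0"
  shows "isCont (williamson \<alpha> F) x"
proof (cases "x > 0")
  case True
  have "(scaled_williamson \<alpha> F has_field_derivative \<alpha> * x powr (\<alpha> - 1) * F x) (at x)"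
    using assms True by (intro scaled_williamson_has_field_derivative) (auto simp: continuous_at)
  then have "isCont (scaled_williamson \<alpha> F) x" by (rule DERIV_isCont)
  then have "isCont (\<lambda>z. scaled_williamson \<alpha> F z / z powr \<alpha>) x"
    using True by (intro continuous_intros) auto
  moreover
  have "eventually (\<lambda>z. z > 0) (nhds x)"
    using True eventually_nhds_in_open[of "{0<..}" x] by simp
  then have "eventually (\<lambda>z. williamson \<alpha> F z = scaled_williamson \<alpha> F z / z powr \<alpha>) (nhds x)"
    by eventually_elim (rule williamson_eq_scaled)
  ultimately show ?thesis by (rule isCont_cong[THEN iffD2, rotated])
next
  case False
  have "F x = 0"
    using False assms by (cases "x = 0") (auto simp: nonneg_df_def)
  then have "(F \<longlongrightarrow> 0) (at x)"
    using assms(3) by (simp add: continuous_at)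
  moreover have "norm (williamson \<alpha> F z) \<le> F z" for z
    using williamson_bounds[OF assms(1,2), of z] williamson_nonpos[OF assms(1,4), of z \<alpha>]
      nonneg_df_bounds[OF assms(1), of z] by (cases "z > 0") auto
  ultimately have "(williamson \<alpha> F \<longlongrightarrow> 0) (at x)"
    by (auto intro: Lim_null_comparison[OF always_eventually, rule_format, of "williamson \<alpha> F" F])
  then show ?thesis
    using williamson_nonpos[OF assms(1,4), of x \<alpha>] False by (simp add: continuous_at)
qed

section \<open>Kendall powers in closed form\<close>

text \<open>The result of applying the inversion \<open>F = G + x G' / \<alpha>\<close> to \<open>G\<^sup>k\<^sup>+\<^sup>1\<close> in place of \<open>G\<close> and
  eliminating \<open>G'\<close>. The index is shifted so that \<open>k\<close> stands for the Kendall power \<open>k + 1\<close>: for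
  the zeroth power the unit mass at \<open>0\<close> is not continuous and has to be kept apart.\<close>

definition kendall_power_formula :: "real \<Rightarrow> (real \<Rightarrow> real) \<Rightarrow> nat \<Rightarrow> real \<Rightarrow> real" where
  "kendall_power_formula \<alpha> F k x
     = real (Suc k) * williamson \<alpha> F x ^ k * F x - real k * williamson \<alpha> F x ^ Suc k"

text \<open>The expression \<open>(k + 1) g\<^sup>k f - k g\<^sup>k\<^sup>+\<^sup>1\<close> is the value at \<open>f\<close> of the tangent of \<open>u\<^sup>k\<^sup>+\<^sup>1\<close> at \<open>g\<close>. Its
  derivative in \<open>g\<close> is \<open>k (k + 1) g\<^sup>k\<^sup>-\<^sup>1 (f - g)\<close>, so it increases in \<open>g\<close> as long as the point of
  tangency stays to the left of \<open>f\<close>. Applied with \<open>G\<close> and \<open>F\<close>, this makes the closed form of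
  the Kendall powers monotone.\<close>

lemma tangent_power_mono:
  fixes g g' f f' :: real
  assumes "0 \<le> g" "g \<le> g'" "g' \<le> f'" "f \<le> f'"
  shows "real (Suc k) * g ^ k * f - real k * g ^ Suc k \<le> real (Suc k) * g' ^ k * f' - real k * g' ^ Suc k"
proof -
  let ?h = "\<lambda>u. real (Suc k) * u ^ k * f' - real k * u ^ Suc k"
  have "real (Suc k) * g ^ k * f \<le> real (Suc k) * g ^ k * f'"
    using assms by (intro mult_left_mono) auto
  moreover have "?h g \<le> ?h g'"
  proof (rule DERIV_nonneg_imp_nondecreasing[OF assms(2)])
    fix u assume u: "g \<le> u" "u \<le> g'"
    have "(?h has_field_derivative real (Suc k) * real k * u ^ (k - 1) * (f' - u)) (at u)"
    proof -
      have "(?h has_field_derivative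
          real (Suc k) * (real k * u ^ (k - 1)) * f' - real k * (real (Suc k) * u ^ k)) (at u)"
        using DERIV_pow[of k u] DERIV_pow[of "Suc k" u]
        by (intro DERIV_diff DERIV_cmult DERIV_cmult_right) auto
      moreover have "real (Suc k) * (real k * u ^ (k - 1)) * f' - real k * (real (Suc k) * u ^ k)
          = real (Suc k) * real k * u ^ (k - 1) * (f' - u)"
        by (cases k) (auto simp: algebra_simps)
      ultimately show ?thesis by simp
    qed
    moreover have "0 \<le> real (Suc k) * real k * u ^ (k - 1) * (f' - u)"
      using u assms by (intro mult_nonneg_nonneg) auto
    ultimately show "\<exists>D. (?h has_field_derivative D) (at u) \<and> 0 \<le> D" by blast
  qed
  ultimately show ?thesis by linarith
qed

lemma nonneg_df_kendall_power_formula: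
  assumes "nonneg_df F" "\<alpha> > 0" "continuous_on UNIV F" "F 0 = 0"
  shows "nonneg_df (kendall_power_formula \<alpha> F k)" "isCont (kendall_power_formula \<alpha> F k) x"
proof -
  let ?G = "williamson \<alpha> F"
  have cont: "isCont F u" for u
    using assms(3) by (simp add: continuous_on_eq_continuous_at)
  have F_nonpos: "F u = 0" if "u \<le> 0" for u
    using assms that by (cases "u = 0") (auto simp: nonneg_df_def)
  have G: "0 \<le> ?G u" "?G u \<le> F u" for u
    using williamson_bounds[OF assms(1,2), of u] williamson_nonpos[OF assms(1,4), of u \<alpha>]
      nonneg_df_bounds[OF assms(1), of u] by (cases "u > 0"; auto)+
  have G_mono: "?G u \<le> ?G v" if "u \<le> v" for u v
    using williamson_mono[OF assms(1,2), of u v] williamson_nonpos[OF assms(1,4), of u \<alpha>] G(1)[of v] that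
    by (cases "u > 0") auto
  show C: "isCont (kendall_power_formula \<alpha> F k) x" for x
    unfolding kendall_power_formula_def
    by (intro continuous_intros isCont_williamson assms cont)
  have "mono (kendall_power_formula \<alpha> F k)"
    unfolding kendall_power_formula_def
  proof (intro monoI tangent_power_mono G G_mono)
    show "F u \<le> F v" if "u \<le> v" for u v
      using assms(1) that by (auto simp: nonneg_df_def mono_def)
  qed
  moreover have "continuous (at_right u) (kendall_power_formula \<alpha> F k)" for u
    using C[of u] by (rule continuous_at_imp_continuous_at_within)
  moreover have "kendall_power_formula \<alpha> F k u = 0" if "u < 0" for u
    using that by (simp add: kendall_power_formula_def F_nonpos williamson_nonpos assms)
  moreover have "(kendall_power_formula \<alpha> F k \<longlongrightarrow> real (Suc k) * 1 ^ k * 1 - real k * 1 ^ Suc k) at_top"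
    unfolding kendall_power_formula_def
    by (intro tendsto_intros williamson_at_top assms) (use assms in \<open>auto simp: nonneg_df_def\<close>)
  ultimately show "nonneg_df (kendall_power_formula \<alpha> F k)"
    by (simp add: nonneg_df_def)
qed

text \<open>Both sides multiplied by \<open>x\<^sup>\<alpha>\<close> vanish at \<open>0\<close> and have the same derivative to the right of \<open>0\<close>,
  since \<open>u G'(u) = \<alpha> (F(u) - G(u))\<close>.\<close>

lemma williamson_kendall_power_formula:
  assumes "nonneg_df F" "\<alpha> > 0" "continuous_on UNIV F" "F 0 = 0" "x > 0"
  shows "williamson \<alpha> (kendall_power_formula \<alpha> F k) x = williamson \<alpha> F x ^ Suc k"
proof -
  let ?G = "williamson \<alpha> F" and ?H = "kendall_power_formula \<alpha> F k"
  let ?D = "\<lambda>u. scaled_williamson \<alpha> ?H u - u powr \<alpha> * ?G u ^ Suc k"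
  note H = nonneg_df_kendall_power_formula[OF assms(1-4), where k = k]
  have cont: "isCont F u" for u
    using assms(3) by (simp add: continuous_on_eq_continuous_at)
  have deriv: "(?D has_field_derivative 0) (at u)" if "u > 0" for u
  proof -
    let ?W = "scaled_williamson \<alpha> F"
    have W: "(?W has_field_derivative \<alpha> * u powr (\<alpha> - 1) * F u) (at u)"
      using cont[of u] that assms by (intro scaled_williamson_has_field_derivative) (auto simp: continuous_at)
    have p: "((\<lambda>u. u powr \<alpha>) has_field_derivative \<alpha> * u powr (\<alpha> - 1)) (at u)"
      by (rule has_real_derivative_powr[OF that])
    have pow: "u powr \<alpha> = u * u powr (\<alpha> - 1)"
      using powr_mult_base[of u "\<alpha> - 1"] that by simp
    have "((\<lambda>u. ?W u / u powr \<alpha>) has_field_derivative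
        (\<alpha> * u powr (\<alpha> - 1) * F u * u powr \<alpha> - ?W u * (\<alpha> * u powr (\<alpha> - 1))) / (u powr \<alpha> * u powr \<alpha>)) (at u)"
      using that by (intro DERIV_divide W p) auto
    moreover have "(\<alpha> * u powr (\<alpha> - 1) * F u * u powr \<alpha> - ?W u * (\<alpha> * u powr (\<alpha> - 1))) / (u powr \<alpha> * u powr \<alpha>)
        = \<alpha> * (F u - ?G u) / u"
      using that by (simp add: scaled_williamson_def pow field_simps)
    ultimately have "((\<lambda>u. ?W u / u powr \<alpha>) has_field_derivative \<alpha> * (F u - ?G u) / u) (at u)"
      by simp
    then have G: "(?G has_field_derivative \<alpha> * (F u - ?G u) / u) (at u)"
      by (rule has_field_derivative_transform_within_open[of _ _ _ "{0<..}"])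
        (use that in \<open>auto simp: williamson_eq_scaled\<close>)
    have "(scaled_williamson \<alpha> ?H has_field_derivative \<alpha> * u powr (\<alpha> - 1) * ?H u) (at u)"
      using H(2)[of u] that assms by (intro scaled_williamson_has_field_derivative H(1)) (auto simp: continuous_at)
    then have "(?D has_field_derivative \<alpha> * u powr (\<alpha> - 1) * ?H u
        - (\<alpha> * u powr (\<alpha> - 1) * ?G u ^ Suc k
           + (1 + real k) * (\<alpha> * (F u - ?G u) / u * ?G u ^ k) * u powr \<alpha>)) (at u)"
      by (intro DERIV_diff DERIV_mult DERIV_power_Suc p G)
    moreover have "\<alpha> * u powr (\<alpha> - 1) * ?H u
        - (\<alpha> * u powr (\<alpha> - 1) * ?G u ^ Suc k
           + (1 + real k) * (\<alpha> * (F u - ?G u) / u * ?G u ^ k) * u powr \<alpha>) = 0"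
      using that by (simp add: kendall_power_formula_def pow field_simps)
    ultimately show ?thesis by simp
  qed
  have at0: "(?D \<longlongrightarrow> 0) (at 0 within {0..x})"
  proof (rule Lim_null_comparison)
    have "((\<lambda>u. u powr \<alpha>) \<longlongrightarrow> 0 powr \<alpha>) (at 0 within {0..x})"
      by (intro tendsto_powr' tendsto_ident_at tendsto_const)
        (use assms(2) in \<open>auto simp: eventually_at_filter\<close>)
    then show "((\<lambda>u. u powr \<alpha>) \<longlongrightarrow> 0) (at 0 within {0..x})" by simp
    show "eventually (\<lambda>u. norm (?D u) \<le> u powr \<alpha>) (at 0 within {0..x})"
      unfolding eventually_at_filter
    proof (intro always_eventually allI impI)
      fix u assume "u \<noteq> 0" "u \<in> {0..x}"
      then have "u > 0" by simp
      have "0 \<le> williamson \<alpha> ?H u" "williamson \<alpha> ?H u \<le> 1" "0 \<le> ?G u ^ Suc k" "?G u ^ Suc k \<le> 1"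
        using williamson_bounds[OF H(1) assms(2) \<open>u > 0\<close>] nonneg_df_bounds[OF H(1), of u]
          williamson_bounds[OF assms(1,2) \<open>u > 0\<close>] nonneg_df_bounds[OF assms(1), of u]
        by (auto intro!: mult_le_one power_le_one)
      then have "\<bar>williamson \<alpha> ?H u - ?G u ^ Suc k\<bar> \<le> 1" by linarith
      then have "u powr \<alpha> * \<bar>williamson \<alpha> ?H u - ?G u ^ Suc k\<bar> \<le> u powr \<alpha> * 1"
        by (intro mult_left_mono) auto
      then show "norm (?D u) \<le> u powr \<alpha>"
        by (simp add: scaled_williamson_def right_diff_distrib[symmetric] abs_mult del: power_Suc)
    qed
  qed
  have D0: "?D 0 = 0" using assms(2) by simp
  have "continuous_on {0..x} ?D"
    unfolding continuous_on_def
  proof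
    fix u assume u: "u \<in> {0..x}"
    show "(?D \<longlongrightarrow> ?D u) (at u within {0..x})"
    proof (cases "u = 0")
      case True
      then show ?thesis using at0 D0 by (simp only:)
    next
      case False
      then have "isCont ?D u" using u DERIV_isCont[OF deriv[of u]] by simp
      then show ?thesis
        unfolding continuous_at by (rule tendsto_within_subset) auto
    qed
  qed
  then have "?D x = ?D 0"
    using assms(5) by (intro DERIV_isconst2[of 0 x ?D] deriv) auto
  then show ?thesis using assms D0 by (simp add: scaled_williamson_def)
qed

lemma williamson_point_mass:
  assumes "x > 0"
  shows "williamson \<alpha> (cdf (return borel 0)) x = 1"
proof -
  have rd: "real_distribution (return borel (0::real))"
    by (auto simp: real_distribution_def real_distribution_axioms_def prob_space_return)
  interpret real_distribution "return borel (0::real)" by (rule rd)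
  have "interval_measure (cdf (return borel 0)) = return borel (0::real)"
    by (intro cdf_unique real_distribution_interval_measure rd cdf_interval_measure
        cdf_nondecreasing cdf_is_right_cont cdf_lim_at_bot cdf_lim_at_top_prob)
  then show ?thesis
    using assms unfolding williamson_def set_lebesgue_integral_def
    by (simp add: integral_return)
qed

text \<open>By injectivity of the transform, the description that defines the convolution singles out the
  closed form.\<close>

lemma kendall_power_eq:
  assumes "nonneg_df F" "\<alpha> > 0" "continuous_on UNIV F" "F 0 = 0"
  shows "kendall_power \<alpha> F (Suc k) = kendall_power_formula \<alpha> F k"
proof (induction k)
  have the: "kendall_conv \<alpha> H F = kendall_power_formula \<alpha> F k"
    if "\<And>x. x > 0 \<Longrightarrow> williamson \<alpha> H x = williamson \<alpha> F x ^ k" for H k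
    unfolding kendall_conv_def
  proof (rule the_equality)
    show K: "nonneg_df (kendall_power_formula \<alpha> F k) \<and> (\<forall>x>0.
        williamson \<alpha> (kendall_power_formula \<alpha> F k) x = williamson \<alpha> H x * williamson \<alpha> F x)"
      using nonneg_df_kendall_power_formula(1)[OF assms] williamson_kendall_power_formula[OF assms]
      by (simp add: that)
    show "F\<^sub>3 = kendall_power_formula \<alpha> F k"
      if "nonneg_df F\<^sub>3 \<and> (\<forall>x>0. williamson \<alpha> F\<^sub>3 x = williamson \<alpha> H x * williamson \<alpha> F x)" for F\<^sub>3
      using that K by (intro williamson_inject[OF assms(2)]) auto
  qed
  {
    case 0
    show ?case using the[of "cdf (return borel 0)" 0] by (simp add: williamson_point_mass)
  next
    case (Suc k)
    then show ?case
      using the[of "kendall_power_formula \<alpha> F k" "Suc k"] williamson_kendall_power_formula[OF assms]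
      by simp
  }
qed

text \<open>The summand for \<open>k\<close> is split as \<open>(k + 1) G\<^sup>k F - G ((k + 1) G\<^sup>k - G\<^sup>k)\<close>, so that only the geometric
  series and its derivative occur; the zeroth power contributes \<open>1\<close>.\<close>

lemma kendall_renewal_eq:
  assumes "nonneg_df F" "\<alpha> > 0" "continuous_on UNIV F" "F 0 = 0" "x > 0"
  shows "kendall_renewal \<alpha> F x = 2 / (1 - williamson \<alpha> F x) - (1 - F x) / (1 - williamson \<alpha> F x)\<^sup>2"
proof -
  let ?g = "williamson \<alpha> F x"
  have "isCont F 0" using assms(3) by (simp add: continuous_on_eq_continuous_at)
  then have g: "0 \<le> ?g" "?g < 1"
    using williamson_lt_1[OF assms(1,2) _ assms(4,5)] williamson_bounds[OF assms(1,2,5)] by auto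
  have s: "(\<lambda>k. real (Suc k) * ?g ^ k) sums (1 / (1 - ?g)\<^sup>2)"
    using geometric_deriv_sums[of ?g] g by simp
  have "(\<lambda>k. real (Suc k) * ?g ^ k * F x - ?g * (real (Suc k) * ?g ^ k - ?g ^ k))
      sums (1 / (1 - ?g)\<^sup>2 * F x - ?g * (1 / (1 - ?g)\<^sup>2 - 1 / (1 - ?g)))"
    using g by (intro sums_diff sums_mult sums_mult2 s geometric_sums) auto
  moreover have "(\<lambda>k. real (Suc k) * ?g ^ k * F x - ?g * (real (Suc k) * ?g ^ k - ?g ^ k))
      = (\<lambda>k. kendall_power \<alpha> F (Suc k) x)"
    by (simp add: kendall_power_eq[OF assms(1-4)] kendall_power_formula_def fun_eq_iff algebra_simps
        del: kendall_power.simps)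
  ultimately have "(\<lambda>k. kendall_power \<alpha> F (Suc k) x)
      sums (1 / (1 - ?g)\<^sup>2 * F x - ?g * (1 / (1 - ?g)\<^sup>2 - 1 / (1 - ?g)))" by simp
  then have "(\<lambda>k. kendall_power \<alpha> F k x)
      sums (1 / (1 - ?g)\<^sup>2 * F x - ?g * (1 / (1 - ?g)\<^sup>2 - 1 / (1 - ?g)) + kendall_power \<alpha> F 0 x)"
    by (rule sums_Suc)
  moreover have "kendall_power \<alpha> F 0 x = 1"
    using assms(5) by (simp add: cdf_def measure_return)
  moreover have "1 / (1 - ?g)\<^sup>2 * F x - ?g * (1 / (1 - ?g)\<^sup>2 - 1 / (1 - ?g)) + 1
      = 2 / (1 - ?g) - (1 - F x) / (1 - ?g)\<^sup>2"
  proof -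
    have "1 / d\<^sup>2 * f - (1 - d) * (1 / d\<^sup>2 - 1 / d) + 1 = 2 / d - (1 - f) / d\<^sup>2"
      if "d \<noteq> 0" for d f :: real
      using that by (simp add: field_simps power2_eq_square)
    from this[of "1 - ?g" "F x"] show ?thesis using g by simp
  qed
  ultimately show ?thesis
    unfolding kendall_renewal_def by (simp add: sums_iff del: kendall_power.simps)
qed

section \<open>Tails and truncated moments\<close>

text \<open>Markov's inequality restricted to \<open>t > x\<close>: the restricted moment still dominates \<open>x\<^sup>p P(X > x)\<close>, and
  it vanishes in the limit by dominated convergence.\<close>

lemma tail_moment_tendsto_0:
  fixes \<mu> :: "real measure"
  assumes "real_distribution \<mu>" "p > 0" "integrable \<mu> (\<lambda>t. t powr p)"
  shows "((\<lambda>x. x powr p * (1 - cdf \<mu> x)) \<longlongrightarrow> 0) at_top"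
proof -
  interpret real_distribution \<mu> by fact
  let ?s = "\<lambda>x t. indicator {x<..} t * t powr p"
  have lim: "((\<lambda>x. LINT t|\<mu>. ?s x t) \<longlongrightarrow> (LINT t|\<mu>. 0)) at_top"
  proof (rule integral_dominated_convergence_at_top[where w = "\<lambda>t. t powr p"])
    show "AE t in \<mu>. ((\<lambda>x. ?s x t) \<longlongrightarrow> 0) at_top"
    proof (rule AE_I2, rule tendsto_eventually)
      fix t show "eventually (\<lambda>x. ?s x t = 0) at_top"
        using eventually_ge_at_top[of t] by eventually_elim simp
    qed
    show "eventually (\<lambda>x. AE t in \<mu>. norm (?s x t) \<le> t powr p) at_top"
      by (intro always_eventually allI AE_I2) (auto simp: indicator_def)
  qed (use assms in auto)
  have tail: "1 - cdf \<mu> x = measure \<mu> {x<..}" for x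
  proof -
    have "{x<..} = space \<mu> - {..x}" by auto
    then show ?thesis using prob_compl[of "{..x}"] by (simp add: cdf_def)
  qed
  have bound: "x powr p * (1 - cdf \<mu> x) \<le> (LINT t|\<mu>. ?s x t)" if "x > 0" for x
  proof -
    have "x powr p * (1 - cdf \<mu> x) = (LINT t|\<mu>. indicator {x<..} t * x powr p)"
      by (simp add: tail)
    also have "\<dots> \<le> (LINT t|\<mu>. ?s x t)"
    proof (rule integral_mono)
      show "integrable \<mu> (\<lambda>t. indicator {x<..} t * x powr p)"
        by (intro integrable_const_bound[where B = "x powr p"]) (auto simp: indicator_def)
      show "integrable \<mu> (?s x)"
        by (rule Bochner_Integration.integrable_bound[OF assms(3)]) (auto simp: indicator_def)
      show "indicator {x<..} t * x powr p \<le> ?s x t" for t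
        using that assms(2) powr_mono2[of p x t] by (auto simp: indicator_def)
    qed
    finally show ?thesis .
  qed
  show ?thesis
  proof (rule tendsto_sandwich)
    show "eventually (\<lambda>x. 0 \<le> x powr p * (1 - cdf \<mu> x)) at_top"
      using cdf_bounded_prob by (intro always_eventually allI mult_nonneg_nonneg) auto
    show "eventually (\<lambda>x. x powr p * (1 - cdf \<mu> x) \<le> (LINT t|\<mu>. ?s x t)) at_top"
      using eventually_gt_at_top[of 0] by eventually_elim (rule bound)
    show "((\<lambda>x. LINT t|\<mu>. ?s x t) \<longlongrightarrow> 0) at_top" using lim by simp
  qed simp
qed

text \<open>For \<open>x > 0\<close> and a nonnegative random variable \<open>X\<close> with distribution function \<open>F\<close> this is
  \<open>E min(X, x)\<^sup>\<alpha>\<close>.\<close>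

definition truncated_moment :: "real \<Rightarrow> (real \<Rightarrow> real) \<Rightarrow> real \<Rightarrow> real" where
  "truncated_moment \<alpha> F x = x powr \<alpha> * (1 - williamson \<alpha> F x)"

text \<open>The increment bounds for the scaled transform, read for the complement: \<open>min(X, x)\<^sup>\<alpha>\<close> only grows on
  the event \<open>X > x\<close>.\<close>

lemma truncated_moment_increment:
  assumes "nonneg_df F" "\<alpha> > 0" "0 \<le> x" "x \<le> z"
  shows "0 \<le> truncated_moment \<alpha> F z - truncated_moment \<alpha> F x"
    and "truncated_moment \<alpha> F z - truncated_moment \<alpha> F x \<le> (1 - F x) * (z powr \<alpha> - x powr \<alpha>)"
proof -
  have eq: "truncated_moment \<alpha> F z - truncated_moment \<alpha> F x
      = (z powr \<alpha> - x powr \<alpha>) - (scaled_williamson \<alpha> F z - scaled_williamson \<alpha> F x)"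
    by (simp add: truncated_moment_def scaled_williamson_def algebra_simps)
  have "x powr \<alpha> \<le> z powr \<alpha>" using assms by (intro powr_mono2) auto
  then have "F z * (z powr \<alpha> - x powr \<alpha>) \<le> 1 * (z powr \<alpha> - x powr \<alpha>)"
    using nonneg_df_bounds[OF assms(1)] by (intro mult_right_mono) auto
  then show "0 \<le> truncated_moment \<alpha> F z - truncated_moment \<alpha> F x"
    using order_trans[OF scaled_williamson_increment(2)[OF assms]] by (simp add: eq)
  show "truncated_moment \<alpha> F z - truncated_moment \<alpha> F x \<le> (1 - F x) * (z powr \<alpha> - x powr \<alpha>)"
    using scaled_williamson_increment(1)[OF assms] eq by (simp add: left_diff_distrib)
qed

lemma truncated_moment_tendsto:
  assumes "nonneg_df F" "\<alpha> > 0" "integrable (interval_measure F) (\<lambda>t. t powr \<alpha>)"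
  shows "(truncated_moment \<alpha> F \<longlongrightarrow> (LINT t|interval_measure F. t powr \<alpha>)) at_top"
proof -
  let ?\<mu> = "interval_measure F"
  interpret real_distribution ?\<mu>
    by (rule nonneg_df_real_distribution[OF assms(1)])
  let ?s = "\<lambda>x t. x powr \<alpha> - indicator {0..x} t * (x powr \<alpha> - t powr \<alpha>) :: real"
  have nonneg: "AE t in ?\<mu>. t \<ge> 0"
  proof (rule AE_I[of _ _ "{..<0}"])
    show "emeasure ?\<mu> {..<0} = 0"
      by (simp add: emeasure_eq_measure nonneg_df_measure_negative[OF assms(1)])
  qed auto
  have eq: "truncated_moment \<alpha> F x = (LINT t|?\<mu>. ?s x t)" for x
  proof -
    have "(LINT t|?\<mu>. ?s x t) = x powr \<alpha> - scaled_williamson \<alpha> F x"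
      using integrable_scaled_williamson[OF assms(1,2)] prob_space
      by (simp add: scaled_williamson_eq_integral)
    then show ?thesis by (simp add: truncated_moment_def scaled_williamson_def algebra_simps)
  qed
  have "((\<lambda>x. LINT t|?\<mu>. ?s x t) \<longlongrightarrow> (LINT t|?\<mu>. t powr \<alpha>)) at_top"
  proof (rule integral_dominated_convergence_at_top[where w = "\<lambda>t. t powr \<alpha>"])
    show "AE t in ?\<mu>. ((\<lambda>x. ?s x t) \<longlongrightarrow> t powr \<alpha>) at_top"
      using nonneg
    proof eventually_elim
      case (elim t)
      have "eventually (\<lambda>x. ?s x t = t powr \<alpha>) at_top"
        using eventually_ge_at_top[of t] by eventually_elim (use elim in simp)
      then show ?case by (rule tendsto_eventually)
    qed
    show "eventually (\<lambda>x. AE t in ?\<mu>. norm (?s x t) \<le> t powr \<alpha>) at_top"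
      using eventually_ge_at_top[of 0]
    proof eventually_elim
      case (elim x)
      show ?case using nonneg
        by eventually_elim (use elim assms(2) powr_mono2[of \<alpha> x] in \<open>auto simp: indicator_def\<close>)
    qed
  qed (use assms in auto)
  then show ?thesis by (simp add: eq[abs_def])
qed

section \<open>Asymptotics of the renewal function\<close>

lemma powr_increment_asymp:
  fixes p y :: real
  assumes "y > 0"
  shows "((\<lambda>x. ((x + y) powr p - x powr p) / x powr (p - 1)) \<longlongrightarrow> p * y) at_top"
    and "((\<lambda>x. (x + y) powr p / x powr p) \<longlongrightarrow> 1) at_top"
proof -
  have inv: "((\<lambda>x. y / x) \<longlongrightarrow> 0) at_top"
    by (intro tendsto_divide_0[OF tendsto_const] filterlim_at_top_imp_at_infinity filterlim_ident)
  have factor: "(x + y) powr p = x powr p * (1 + y / x) powr p" if "x > 0" for x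
  proof -
    have "x + y = x * (1 + y / x)" using that by (simp add: field_simps)
    then show ?thesis using that assms by (simp add: powr_mult del: mult.right_neutral)
  qed
  have "((\<lambda>x. (1 + y / x) powr p) \<longlongrightarrow> (1 + 0) powr p) at_top"
    by (intro tendsto_intros inv) auto
  moreover have "eventually (\<lambda>x. (1 + y / x) powr p = (x + y) powr p / x powr p) at_top"
    using eventually_gt_at_top[of 0] by eventually_elim (simp add: factor)
  ultimately show "((\<lambda>x. (x + y) powr p / x powr p) \<longlongrightarrow> 1) at_top"
    by (simp add: Lim_transform_eventually)
  have "((\<lambda>h. ((1 + h) powr p - 1) / h) \<longlongrightarrow> p) (at 0)"
    using has_real_derivative_powr[of 1 p] by (simp add: DERIV_def)
  moreover have "filterlim (\<lambda>x. y / x) (at 0) at_top"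
    using inv eventually_gt_at_top[of 0] assms
    by (auto simp: filterlim_at elim: eventually_mono)
  ultimately have "((\<lambda>x. ((1 + y / x) powr p - 1) / (y / x)) \<longlongrightarrow> p) at_top"
    by (rule filterlim_compose)
  then have "((\<lambda>x. y * (((1 + y / x) powr p - 1) / (y / x))) \<longlongrightarrow> y * p) at_top"
    by (rule tendsto_mult_left)
  moreover have "eventually (\<lambda>x. y * (((1 + y / x) powr p - 1) / (y / x))
      = ((x + y) powr p - x powr p) / x powr (p - 1)) at_top"
    using eventually_gt_at_top[of 0]
  proof eventually_elim
    case (elim x)
    have "x powr p = x * x powr (p - 1)" using powr_mult_base[of x "p - 1"] elim by simp
    then show ?case using elim assms by (simp add: factor field_simps)
  qed
  ultimately show "((\<lambda>x. ((x + y) powr p - x powr p) / x powr (p - 1)) \<longlongrightarrow> p * y) at_top"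
    by (simp add: mult.commute Lim_transform_eventually)
qed

text \<open>The increment of the closed form is expanded into five terms, each a product of quantities with a
  known limit. Only the first survives: \<open>d\<close> is the normalised increment of \<open>x\<^sup>\<alpha>\<close>, while \<open>P\<close>
  (tail), \<open>E\<close> (increment of the truncated moment) and \<open>T\<close> (increment of the tail) tend to \<open>0\<close>.\<close>

lemma kendall_blackwell:
  assumes "nonneg_df F" "\<alpha> > 0" "continuous_on UNIV F" "F 0 = 0" "y > 0"
    and int: "integrable (interval_measure F) (\<lambda>t. t powr \<alpha>)"
    and increment: "((\<lambda>x. x powr (\<alpha> + 1) * (tail F (x + y) - tail F x)) \<longlongrightarrow> 0) at_top"
  shows "((\<lambda>x. 1 / x powr (\<alpha> - 1) * (kendall_renewal \<alpha> F (x + y) - kendall_renewal \<alpha> F x))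
           \<longlongrightarrow> 2 * \<alpha> / (LINT t|interval_measure F. t powr \<alpha>) * y) at_top"
proof -
  define m where "m = (LINT t|interval_measure F. t powr \<alpha>)"
  define I where "I = truncated_moment \<alpha> F"
  define d where "d x = ((x + y) powr \<alpha> - x powr \<alpha>) / x powr (\<alpha> - 1)" for x
  define r where "r x = (x + y) powr \<alpha> / x powr \<alpha>" for x
  define P where "P x = x powr \<alpha> * (1 - F x)" for x
  define E where "E x = x * (I (x + y) - I x)" for x
  define T where "T x = x powr (\<alpha> + 1) * (tail F (x + y) - tail F x)" for x
  have I_pos: "I x > 0" if "x > 0" for x
    using williamson_lt_1[OF assms(1,2) _ assms(4) that] assms(3) that
    by (simp add: I_def truncated_moment_def continuous_on_eq_continuous_at)
  have I_lim: "(I \<longlongrightarrow> m) at_top"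
    unfolding I_def m_def by (intro truncated_moment_tendsto assms)
  have shift: "filterlim (\<lambda>x. x + y) at_top at_top"
    using filterlim_tendsto_add_at_top[OF tendsto_const filterlim_ident, of y]
    by (simp add: add.commute)
  have K_lim: "((\<lambda>x. I (x + y)) \<longlongrightarrow> m) at_top"
    by (rule filterlim_compose[OF I_lim shift])
  have "m \<ge> I 1"
  proof (rule tendsto_lowerbound[OF I_lim])
    show "eventually (\<lambda>x. I 1 \<le> I x) at_top"
      using eventually_ge_at_top[of 1]
      by eventually_elim (use truncated_moment_increment(1)[OF assms(1,2), of 1] in \<open>simp add: I_def\<close>)
  qed simp
  then have m: "m > 0" using I_pos[of 1] by simp
  have d_lim: "(d \<longlongrightarrow> \<alpha> * y) at_top" and r_lim: "(r \<longlongrightarrow> 1) at_top"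
    unfolding d_def r_def by (rule powr_increment_asymp[OF assms(5)])+
  have P_lim: "(P \<longlongrightarrow> 0) at_top"
    using tail_moment_tendsto_0[OF nonneg_df_real_distribution[OF assms(1)] assms(2) int]
    by (simp add: P_def[abs_def] nonneg_df_cdf[OF assms(1)])
  have pow: "x powr \<alpha> = x * x powr (\<alpha> - 1)" if "x > 0" for x
    using powr_mult_base[of x "\<alpha> - 1"] that by simp
  have E_lim: "(E \<longlongrightarrow> 0) at_top"
  proof (rule tendsto_sandwich)
    show "eventually (\<lambda>x. 0 \<le> E x) at_top"
      using eventually_gt_at_top[of 0]
      by eventually_elim
        (use truncated_moment_increment(1)[OF assms(1,2)] assms(5) in \<open>simp add: E_def I_def\<close>)
    show "eventually (\<lambda>x. E x \<le> P x * d x) at_top"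
      using eventually_gt_at_top[of 0]
    proof eventually_elim
      case (elim x)
      have "E x \<le> x * ((1 - F x) * ((x + y) powr \<alpha> - x powr \<alpha>))"
        unfolding E_def I_def using elim assms(5)
        by (intro mult_left_mono truncated_moment_increment(2)[OF assms(1,2)]) auto
      also have "\<dots> = P x * d x"
        using elim by (simp add: P_def d_def pow)
      finally show ?case .
    qed
    show "((\<lambda>x. P x * d x) \<longlongrightarrow> 0) at_top"
      using tendsto_mult[OF P_lim d_lim] by simp
  qed simp
  have R: "kendall_renewal \<alpha> F x = 2 * x powr \<alpha> / I x - (1 - F x) * (x powr \<alpha>)\<^sup>2 / (I x)\<^sup>2"
    if "x > 0" for x
    using that by (simp add: kendall_renewal_eq[OF assms(1-4) that] I_def truncated_moment_def
        power_mult_distrib)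
  let ?S = "\<lambda>x. 2 * d x / I (x + y) - 2 * E x / (I x * I (x + y))
      - T x * (r x)\<^sup>2 / (I (x + y))\<^sup>2 - P x * d x * (r x + 1) / (I (x + y))\<^sup>2
      + P x * E x * (I (x + y) + I x) / ((I x)\<^sup>2 * (I (x + y))\<^sup>2)"
  have "(?S \<longlongrightarrow> 2 * (\<alpha> * y) / m - 2 * 0 / (m * m)
      - 0 * 1\<^sup>2 / m\<^sup>2 - 0 * (\<alpha> * y) * (1 + 1) / m\<^sup>2 + 0 * 0 * (m + m) / (m\<^sup>2 * m\<^sup>2)) at_top"
    using m by (intro tendsto_intros I_lim K_lim d_lim r_lim P_lim E_lim increment[folded T_def]) auto
  moreover have "eventually (\<lambda>x. ?S x
      = 1 / x powr (\<alpha> - 1) * (kendall_renewal \<alpha> F (x + y) - kendall_renewal \<alpha> F x)) at_top"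
    using eventually_gt_at_top[of 0]
  proof eventually_elim
    case (elim x)
    (* Here c, J, K, b, q, p stand for x powr (\<alpha> - 1), I x, I (x + y), (x + y) powr \<alpha> and the
       tails at x + y and x, so that x powr \<alpha> = x * c and x powr (\<alpha> + 1) = x * (x * c). *)
    have alg: "2 * ((b - x * c) / c) / K - 2 * (x * (K - J)) / (J * K)
        - x * (x * c) * (q - p) * (b / (x * c))\<^sup>2 / K\<^sup>2
        - x * c * p * ((b - x * c) / c) * (b / (x * c) + 1) / K\<^sup>2
        + x * c * p * (x * (K - J)) * (K + J) / (J\<^sup>2 * K\<^sup>2)
        = 1 / c * ((2 * b / K - q * b\<^sup>2 / K\<^sup>2) - (2 * (x * c) / J - p * (x * c)\<^sup>2 / J\<^sup>2))"
      if "x \<noteq> 0" "c \<noteq> 0" "J \<noteq> 0" "K \<noteq> 0" for b c J K p q :: real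
      using that by (simp add: divide_simps) algebra
    have "x powr (\<alpha> + 1) = x * (x * x powr (\<alpha> - 1))"
      using elim by (simp add: pow[symmetric] powr_add)
    then show ?case
      using alg[of "x powr (\<alpha> - 1)" "I x" "I (x + y)" "(x + y) powr \<alpha>" "1 - F (x + y)" "1 - F x"]
        elim I_pos[of x] I_pos[of "x + y"] assms(5)
      by (simp only: d_def r_def P_def E_def T_def tail_def R pow[OF elim]) simp
  qed
  ultimately have "((\<lambda>x. 1 / x powr (\<alpha> - 1) * (kendall_renewal \<alpha> F (x + y) - kendall_renewal \<alpha> F x))
      \<longlongrightarrow> 2 * (\<alpha> * y) / m) at_top"
    by (simp add: Lim_transform_eventually)
  then show ?thesis by (simp add: m_def ac_simps)
qed

text \<open>For the moment of order \<open>1 + \<alpha>\<close>, both hypotheses of the first part are deduced: \<open>X\<^sup>\<alpha>\<close> is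
  dominated by \<open>1 + X\<^sup>1\<^sup>+\<^sup>\<alpha>\<close>, and the tail increment is at most the tail itself.\<close>

theorem theorem8:
  fixes M :: "'a measure" and X :: "'a \<Rightarrow> real" and F :: "real \<Rightarrow> real" and \<alpha> y :: real
  assumes "\<alpha> > 0"
    and "prob_space M"
    and "X \<in> borel_measurable M"
    and "AE \<omega> in M. X \<omega> > 0"
    and "F = cdf (distr M borel X)"
    and "continuous_on UNIV F"
    and "y > 0"
  shows "(integrable M (\<lambda>\<omega>. X \<omega> powr \<alpha>) \<longrightarrow>
          ((\<lambda>x. x powr (\<alpha> + 1) * (tail F (x + y) - tail F x)) \<longlongrightarrow> 0) at_top \<longrightarrow>
          ((\<lambda>x. 1 / x powr (\<alpha> - 1) * (kendall_renewal \<alpha> F (x + y) - kendall_renewal \<alpha> F x))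
             \<longlongrightarrow> 2 * \<alpha> / prob_space.expectation M (\<lambda>\<omega>. X \<omega> powr \<alpha>) * y) at_top)
       \<and> (integrable M (\<lambda>\<omega>. X \<omega> powr (1 + \<alpha>)) \<longrightarrow>
          ((\<lambda>x. 1 / x powr (\<alpha> - 1) * (kendall_renewal \<alpha> F (x + y) - kendall_renewal \<alpha> F x))
             \<longlongrightarrow> 2 * \<alpha> / prob_space.expectation M (\<lambda>\<omega>. X \<omega> powr \<alpha>) * y) at_top)"
proof -
  interpret M: prob_space M by fact
  note [measurable] = assms(3)
  let ?\<mu> = "distr M borel X"
  have rd: "real_distribution ?\<mu>"
    by (auto simp: real_distribution_def real_distribution_axioms_def M.prob_space_distr)
  interpret \<mu>: real_distribution ?\<mu> by (rule rd)
  have F_nonpos: "F x = 0" if "x \<le> 0" for x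
  proof -
    have "measure M {\<omega> \<in> space M. X \<omega> \<le> x} = 0"
      by (rule M.prob_eq_0[THEN iffD2]) (use assms(4) that in \<open>auto elim: eventually_mono\<close>)
    moreover have "F x = measure M {\<omega> \<in> space M. X \<omega> \<le> x}"
      by (simp add: assms(5) cdf_def measure_distr vimage_def Int_def conj_commute)
    ultimately show ?thesis by simp
  qed
  have df: "nonneg_df F"
    using F_nonpos \<mu>.cdf_nondecreasing \<mu>.cdf_is_right_cont \<mu>.cdf_lim_at_top_prob
    by (auto simp: nonneg_df_def mono_def assms(5))
  have \<mu>: "interval_measure F = ?\<mu>"
    by (intro cdf_unique nonneg_df_real_distribution df rd) (simp add: nonneg_df_cdf df assms(5)[symmetric])
  have int_iff: "integrable (interval_measure F) (\<lambda>t. t powr p) \<longleftrightarrow> integrable M (\<lambda>\<omega>. X \<omega> powr p)" for p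
    unfolding \<mu> by (rule integrable_distr_eq) auto
  have mean: "(LINT t|interval_measure F. t powr \<alpha>) = M.expectation (\<lambda>\<omega>. X \<omega> powr \<alpha>)"
    unfolding \<mu> by (rule integral_distr) auto
  have main: "((\<lambda>x. 1 / x powr (\<alpha> - 1) * (kendall_renewal \<alpha> F (x + y) - kendall_renewal \<alpha> F x))
      \<longlongrightarrow> 2 * \<alpha> / M.expectation (\<lambda>\<omega>. X \<omega> powr \<alpha>) * y) at_top"
    if "integrable M (\<lambda>\<omega>. X \<omega> powr \<alpha>)"
      "((\<lambda>x. x powr (\<alpha> + 1) * (tail F (x + y) - tail F x)) \<longlongrightarrow> 0) at_top"
    using kendall_blackwell[OF df assms(1,6) F_nonpos assms(7) _ that(2)] that(1)
    by (simp add: int_iff mean)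
  moreover have "integrable M (\<lambda>\<omega>. X \<omega> powr \<alpha>)"
    if "integrable M (\<lambda>\<omega>. X \<omega> powr (1 + \<alpha>))"
  proof (rule Bochner_Integration.integrable_bound)
    show "integrable M (\<lambda>\<omega>. 1 + X \<omega> powr (1 + \<alpha>))" using that by simp
    have "u powr \<alpha> \<le> 1 + u powr (1 + \<alpha>)" if "u > 0" for u :: real
    proof (cases "u \<le> 1")
      case True
      then have "u powr \<alpha> \<le> 1" using that assms(1) by (intro powr_le1) auto
      then show ?thesis by (simp add: add_increasing2)
    next
      case False
      then have "u powr \<alpha> \<le> u powr (1 + \<alpha>)" by (intro powr_mono) auto
      then show ?thesis by simp
    qed
    then show "AE \<omega> in M. norm (X \<omega> powr \<alpha>) \<le> norm (1 + X \<omega> powr (1 + \<alpha>))"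
      using assms(4) by (auto elim!: eventually_mono)
  qed auto
  moreover have "((\<lambda>x. x powr (\<alpha> + 1) * (tail F (x + y) - tail F x)) \<longlongrightarrow> 0) at_top"
    if "integrable M (\<lambda>\<omega>. X \<omega> powr (1 + \<alpha>))"
  proof (rule Lim_null_comparison)
    have "((\<lambda>x. x powr (1 + \<alpha>) * (1 - cdf (interval_measure F) x)) \<longlongrightarrow> 0) at_top"
      using that assms(1)
      by (intro tail_moment_tendsto_0 nonneg_df_real_distribution df) (auto simp: int_iff)
    then show "((\<lambda>x. x powr (\<alpha> + 1) * (1 - F x)) \<longlongrightarrow> 0) at_top"
      by (simp add: nonneg_df_cdf[OF df] add.commute)
    show "eventually (\<lambda>x. norm (x powr (\<alpha> + 1) * (tail F (x + y) - tail F x))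
        \<le> x powr (\<alpha> + 1) * (1 - F x)) at_top"
    proof (intro always_eventually allI)
      fix x
      have "\<bar>tail F (x + y) - tail F x\<bar> \<le> 1 - F x"
        using df assms(7) nonneg_df_bounds[OF df, of "x + y"]
        by (auto simp: tail_def nonneg_df_def mono_def)
      then show "norm (x powr (\<alpha> + 1) * (tail F (x + y) - tail F x)) \<le> x powr (\<alpha> + 1) * (1 - F x)"
        by (simp add: abs_mult mult_left_mono)
    qed
  qed
  ultimately show ?thesis by blast
qed

end
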